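(* The Racah coefficients for $sl(2)$ and for the Jordanian quantum algebra $\mathcal U_h(sl(2))$ coincide: $W_h(abec;df)=W(abec;df)$ for all spins $a,b,c,d,e,f$ for which they are defined.
   Context: $sl(2)$ has generators $J_\pm,J_0$ with $[J_0,J_\pm]=\pm2J_\pm$, $[J_+,J_-]=J_0$. $\mathcal U_h(sl(2))$ has the same commutation relations, with coproduct $\tilde\Delta=\mathcal F\Delta\mathcal F^{-1}$, where $\Delta$ is the usual (primitive) coproduct and $\mathcal F=\exp(-\tfrac12J_0\otimes\sigma)$, $\sigma=-\ln(1-2hJ_+)$, $h$ a parameter. The spin-$j$ irreducible representation $V^j$, with basis $e^j_m$ ($-j\le m\le j$), is the same for both algebras: $J_\pm e^j_m=\sqrt{(j\mp m)(j\pm m+1)}\,e^j_{m\pm1}$, $J_0e^j_m=2me^j_m$. In $V^{j_1}\otimes V^{j_2}$ the irreducible component of spin $j$ of $\mathcal U_h(sl(2))$ has basis $e^{(j_1j_2)j}_m=\sum_{m_1,m_2}C^{j_1,j_2,j}_{m_1,m_2,m}\,\mathcal F\,(e^{j_1}_{m_1}\otimes e^{j_2}_{m_2})$, where $C$ denotes the Clebsch–Gordan coefficients of $sl(2)$. In $V^a\otimes V^b\otimes V^c$, coupling $V^a\otimes V^b$ to spin $d$ first and then with $V^c$ to total spin $e$ gives $$\psi^e_\epsilon=\sum C^{d,c,e}_{\delta,\gamma,\epsilon}\,C^{a,b,d}_{\alpha,\beta,\delta}\,(\tilde\Delta\otimes\mathrm{id})(\mathcal F)\,\mathcal F_{12}\;e^a_\alpha\otimes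 e^b_\beta\otimes e^c_\gamma,$$ and coupling $V^b\otimes V^c$ to spin $f$ first and then with $V^a$ to total spin $e$ gives $$\psi'^e_\epsilon=\sum C^{a,f,e}_{\alpha,\rho,\epsilon}\,C^{b,c,f}_{\beta,\gamma,\rho}\,(\mathrm{id}\otimes\tilde\Delta)(\mathcal F)\,\mathcal F_{23}\;e^a_\alpha\otimes e^b_\beta\otimes e^c_\gamma .$$ The Racah coefficients $W_h$ of $\mathcal U_h(sl(2))$ are defined by $\psi^e_\epsilon=\sum_f\sqrt{(2d+1)(2f+1)}\,W_h(abec;df)\,\psi'^e_\epsilon$. The Racah coefficients $W$ of $sl(2)$ are defined in the same way with $h=0$ (i.e. $\mathcal F=1$). *)

theory Defs
  imports Complex_Main
begin

text \<open>
  Vectors are functions from an index set of basis labels to the complex numbers, and \<open>V\<^sup>j\<close> is the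
  subspace of functions supported on the labels \<open>-j, -j+1, \<dots>, j\<close>; the operators of the
  spin-\<open>j\<close> representation are extended by zero to all functions. A tensor product is indexed by
  pairs of labels. On these representations \<open>J\<^sub>+\<close> is nilpotent, so all the operator series below
  have only finitely many nonzero terms at every vector.
\<close>

type_synonym 'i vec = "'i \<Rightarrow> complex"
type_synonym 'i operator = "'i vec \<Rightarrow> 'i vec"

definition basis_vec :: "'i \<Rightarrow> 'i vec" where
  "basis_vec i = (\<lambda>k. if k = i then 1 else 0)"

definition op_exp :: "'i operator \<Rightarrow> 'i operator" where
  "op_exp X = (\<lambda>v i. \<Sum>n. (X ^^ n) v i / fact n)"

text \<open>The Mercator series \<open>ln X = \<Sum>\<^sub>n (-1)\<^sup>n (X - 1)\<^sup>n\<^sup>+\<^sup>1 / (n + 1)\<close>.\<close>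

definition op_ln :: "'i operator \<Rightarrow> 'i operator" where
  "op_ln X = (\<lambda>v i. \<Sum>n. (-1) ^ n * ((\<lambda>w k. X w k - w k) ^^ Suc n) v i / of_nat (Suc n))"

text \<open>\<open>X \<otimes> Y\<close> applies \<open>Y\<close> to the second and then \<open>X\<close> to the first tensor factor.\<close>

definition op_tensor :: "'i operator \<Rightarrow> 'j operator \<Rightarrow> ('i \<times> 'j) operator" (infixr "\<otimes>" 75) where
  "X \<otimes> Y = (\<lambda>v (i, j). X (\<lambda>i'. Y (\<lambda>j'. v (i', j')) j) i)"

definition vec_tensor :: "'i vec \<Rightarrow> 'j vec \<Rightarrow> ('i \<times> 'j) vec" (infixr "\<otimes>\<^sub>v" 75) where
  "v \<otimes>\<^sub>v w = (\<lambda>(i, j). v i * w j)"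

record 'i sl2_rep =
  Jplus :: "'i operator"
  Jminus :: "'i operator"
  Jzero :: "'i operator"

definition spin :: "real \<Rightarrow> bool" where
  "spin j \<longleftrightarrow> 2 * j \<in> \<nat>"

definition weights :: "real \<Rightarrow> real set" where
  "weights j = {m. -j \<le> m \<and> m \<le> j \<and> j - m \<in> \<int>}"

definition spin_rep :: "real \<Rightarrow> real sl2_rep" where
  "spin_rep j =
    \<lparr> Jplus = (\<lambda>v i. \<Sum>m\<in>weights j. v m * sqrt ((j - m) * (j + m + 1)) * basis_vec (m + 1) i),
      Jminus = (\<lambda>v i. \<Sum>m\<in>weights j. v m * sqrt ((j + m) * (j - m + 1)) * basis_vec (m - 1) i),
      Jzero = (\<lambda>v i. \<Sum>m\<in>weights j. v m * (2 * m) * basis_vec m i) \<rparr>"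

text \<open>\<open>\<sigma> = - ln (1 - 2 h J\<^sub>+)\<close> and \<open>\<F> = exp (- 1/2 J\<^sub>0 \<otimes> \<sigma>)\<close>, acting on the tensor product of
  two representations \<open>R\<close> and \<open>S\<close>.\<close>

definition sigma :: "complex \<Rightarrow> 'i sl2_rep \<Rightarrow> 'i operator" where
  "sigma h R = (\<lambda>v i. - op_ln (\<lambda>w k. w k - 2 * h * Jplus R w k) v i)"

definition twist :: "complex \<Rightarrow> 'i sl2_rep \<Rightarrow> 'j sl2_rep \<Rightarrow> ('i \<times> 'j) operator" where
  "twist h R S = op_exp (\<lambda>v p. - (1 / 2) * (Jzero R \<otimes> sigma h S) v p)"

definition primitive_coproduct :: "'i operator \<Rightarrow> 'j operator \<Rightarrow> ('i \<times> 'j) operator" where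
  "primitive_coproduct X Y = (\<lambda>v p. (X \<otimes> id) v p + (id \<otimes> Y) v p)"

text \<open>The representation of \<open>\<U>\<^sub>h(sl(2))\<close> on a tensor product, via the coproduct
  \<open>\<F> \<Delta> \<F>\<^sup>-\<^sup>1\<close>.\<close>

definition tensor_rep ::
  "complex \<Rightarrow> 'i sl2_rep \<Rightarrow> 'j sl2_rep \<Rightarrow> ('i \<times> 'j) sl2_rep" where
  "tensor_rep h R S =
    \<lparr> Jplus = twist h R S \<circ> primitive_coproduct (Jplus R) (Jplus S) \<circ> inv (twist h R S),
      Jminus = twist h R S \<circ> primitive_coproduct (Jminus R) (Jminus S) \<circ> inv (twist h R S),
      Jzero = twist h R S \<circ> primitive_coproduct (Jzero R) (Jzero S) \<circ> inv (twist h R S) \<rparr>"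

definition triangle :: "real \<Rightarrow> real \<Rightarrow> real \<Rightarrow> bool" where
  "triangle j1 j2 j \<longleftrightarrow> \<bar>j1 - j2\<bar> \<le> j \<and> j \<le> j1 + j2 \<and> j1 + j2 - j \<in> \<int>"

definition rfact :: "real \<Rightarrow> real" where
  "rfact x = fact (nat \<lfloor>x\<rfloor>)"

text \<open>Clebsch--Gordan coefficients \<open>C\<^sup>j\<^sup>1\<^sup>,\<^sup>j\<^sup>2\<^sup>,\<^sup>j\<^sub>m\<^sub>1\<^sub>,\<^sub>m\<^sub>2\<^sub>,\<^sub>m\<close> in the Condon--Shortley phase convention, by
  Racah's formula. The sum runs over those \<open>k\<close> for which every factorial has a nonnegative
  argument.\<close>

definition clebsch_gordan :: "real \<Rightarrow> real \<Rightarrow> real \<Rightarrow> real \<Rightarrow> real \<Rightarrow> real \<Rightarrow> real" where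
  "clebsch_gordan j1 j2 j m1 m2 m =
    (if triangle j1 j2 j \<and> m1 \<in> weights j1 \<and> m2 \<in> weights j2 \<and> m \<in> weights j \<and> m = m1 + m2
     then
       sqrt ((2 * j + 1) * rfact (j + j1 - j2) * rfact (j - j1 + j2) * rfact (j1 + j2 - j)
             / rfact (j1 + j2 + j + 1))
       * sqrt (rfact (j + m) * rfact (j - m) * rfact (j1 - m1) * rfact (j1 + m1)
               * rfact (j2 - m2) * rfact (j2 + m2))
       * (\<Sum>k \<in> {k :: nat. real k \<le> j1 + j2 - j \<and> real k \<le> j1 - m1 \<and> real k \<le> j2 + m2
                      \<and> 0 \<le> j - j2 + m1 + real k \<and> 0 \<le> j - j1 - m2 + real k}.
            (-1) ^ k / (fact k * rfact (j1 + j2 - j - real k) * rfact (j1 - m1 - real k)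
              * rfact (j2 + m2 - real k) * rfact (j - j2 + m1 + real k)
              * rfact (j - j1 - m2 + real k)))
     else 0)"

text \<open>The coupled basis vectors of \<open>V\<^sup>a \<otimes> V\<^sup>b \<otimes> V\<^sup>c\<close>. \<open>(\<Delta> \<otimes> id)(\<F>)\<close>, for the twisted coproduct
  \<open>\<Delta>\<close>, acts on \<open>(V\<^sup>a \<otimes> V\<^sup>b) \<otimes> V\<^sup>c\<close> as \<open>\<F>\<close> does for the twisted tensor product
  representation on \<open>V\<^sup>a \<otimes> V\<^sup>b\<close> and the representation on \<open>V\<^sup>c\<close>; similarly for \<open>(id \<otimes> \<Delta>)(\<F>)\<close>.\<close>

definition psi_left ::
  "complex \<Rightarrow> real \<Rightarrow> real \<Rightarrow> real \<Rightarrow> real \<Rightarrow> real \<Rightarrow> real \<Rightarrow> ((real \<times> real) \<times> real) vec" where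
  "psi_left h a b c d e \<epsilon> = (\<lambda>p.
    \<Sum>\<alpha>\<in>weights a. \<Sum>\<beta>\<in>weights b. \<Sum>\<gamma>\<in>weights c. \<Sum>\<delta>\<in>weights d.
      of_real (clebsch_gordan d c e \<delta> \<gamma> \<epsilon> * clebsch_gordan a b d \<alpha> \<beta> \<delta>)
      * twist h (tensor_rep h (spin_rep a) (spin_rep b)) (spin_rep c)
          ((twist h (spin_rep a) (spin_rep b) \<otimes> id)
            ((basis_vec \<alpha> \<otimes>\<^sub>v basis_vec \<beta>) \<otimes>\<^sub>v basis_vec \<gamma>)) p)"

definition psi_right ::
  "complex \<Rightarrow> real \<Rightarrow> real \<Rightarrow> real \<Rightarrow> real \<Rightarrow> real \<Rightarrow> real \<Rightarrow> (real \<times> (real \<times> real)) vec" where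
  "psi_right h a b c f e \<epsilon> = (\<lambda>p.
    \<Sum>\<alpha>\<in>weights a. \<Sum>\<beta>\<in>weights b. \<Sum>\<gamma>\<in>weights c. \<Sum>\<rho>\<in>weights f.
      of_real (clebsch_gordan a f e \<alpha> \<rho> \<epsilon> * clebsch_gordan b c f \<beta> \<gamma> \<rho>)
      * twist h (spin_rep a) (tensor_rep h (spin_rep b) (spin_rep c))
          ((id \<otimes> twist h (spin_rep b) (spin_rep c))
            (basis_vec \<alpha> \<otimes>\<^sub>v (basis_vec \<beta> \<otimes>\<^sub>v basis_vec \<gamma>))) p)"

text \<open>The spins \<open>f\<close> to which \<open>V\<^sup>b \<otimes> V\<^sup>c\<close> can be coupled such that coupling with \<open>V\<^sup>a\<close> can give
  total spin \<open>e\<close>.\<close>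

definition intermediate_spins :: "real \<Rightarrow> real \<Rightarrow> real \<Rightarrow> real \<Rightarrow> real set" where
  "intermediate_spins a b c e = {f. spin f \<and> triangle b c f \<and> triangle a f e}"

text \<open>\<open>W\<close> is the family \<open>f \<mapsto> W\<^sub>h(abec;df)\<close>: the same coefficients expand \<open>psi_left\<close> in the
  \<open>psi_right\<close> for all \<open>\<epsilon>\<close>. The two bracketings of the threefold tensor product are identified
  componentwise. Outside the admissible \<open>f\<close> the family is normalised to zero.\<close>

definition racah_family ::
  "complex \<Rightarrow> real \<Rightarrow> real \<Rightarrow> real \<Rightarrow> real \<Rightarrow> real \<Rightarrow> (real \<Rightarrow> complex) \<Rightarrow> bool" where
  "racah_family h a b e c d W \<longleftrightarrow>
    (\<forall>f. f \<notin> intermediate_spins a b c e \<longrightarrow> W f = 0) \<and>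
    (\<forall>\<epsilon>\<in>weights e. \<forall>\<alpha> \<beta> \<gamma>.
      psi_left h a b c d e \<epsilon> ((\<alpha>, \<beta>), \<gamma>) =
      (\<Sum>f\<in>intermediate_spins a b c e.
        of_real (sqrt ((2 * d + 1) * (2 * f + 1))) * W f * psi_right h a b c f e \<epsilon> (\<alpha>, (\<beta>, \<gamma>))))"

text \<open>For admissible spins there is exactly one such family: at \<open>h = 0\<close> and fixed \<open>e\<close>, \<open>\<epsilon>\<close> the
  \<open>psi_right\<close> are orthonormal and, by complete reducibility and Schur's lemma, they expand
  \<open>psi_left\<close> with coefficients independent of \<open>\<epsilon>\<close>; the twists are invertible.\<close>

definition racah ::
  "complex \<Rightarrow> real \<Rightarrow> real \<Rightarrow> real \<Rightarrow> real \<Rightarrow> real \<Rightarrow> real \<Rightarrow> complex" where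
  "racah h a b e c d f = (THE W. racah_family h a b e c d W) f"

end

theory Submission
  imports Defs "HOL-Computational_Algebra.Formal_Power_Series"
begin

text \<open>
  The twist \<open>\<F>\<close> conjugates \<open>J\<^sub>+ \<otimes> 1\<close> into \<open>J\<^sub>+ \<otimes> (1 - 2 h J\<^sub>+)\<close>, so \<open>1 - 2 h J\<^sub>+\<close> is group-like and \<open>\<sigma>\<close>
  primitive for the deformed coproduct. Hence \<open>\<F>\<close> satisfies the cocycle identity: the operators
  \<open>(\<Delta> \<otimes> id)(\<F>) \<F>\<^sub>1\<^sub>2\<close> and \<open>(id \<otimes> \<Delta>)(\<F>) \<F>\<^sub>2\<^sub>3\<close> coincide. The two coupled bases for \<open>h\<close> therefore arise from
  those for \<open>h = 0\<close> by one and the same invertible operator, which leaves the coefficients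
  of their mutual expansion unchanged.
\<close>

unbundle fps_syntax

subsection \<open>Formal power series at nilpotent elements\<close>

definition nilpotent :: "'a::ring_1 \<Rightarrow> bool" where
  "nilpotent x \<longleftrightarrow> (\<exists>n. x ^ n = 0)"

text \<open>The sum is finite exactly for nilpotent \<open>x\<close>; otherwise it is the junk value \<open>0\<close>.\<close>

definition fps_at :: "real fps \<Rightarrow> 'a::real_algebra_1 \<Rightarrow> 'a" where
  "fps_at F x = (\<Sum>n | x ^ n \<noteq> 0. (F $ n) *\<^sub>R x ^ n)"

lemma power_eq_0_mono: "x ^ N = 0 \<Longrightarrow> N \<le> n \<Longrightarrow> x ^ n = (0 :: 'a::ring_1)"
  by (metis le_add_diff_inverse mult_zero_left power_add)

lemma fps_at_eq: "x ^ N = 0 \<Longrightarrow> fps_at F x = (\<Sum>n<N. (F $ n) *\<^sub>R x ^ n)"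
  unfolding fps_at_def
  by (rule sum.mono_neutral_left) (auto intro: power_eq_0_mono simp: not_le[symmetric])

text \<open>Products at or beyond total degree \<open>N\<close> vanish, so the square of index pairs
  shrinks to the triangle \<open>i + j < N\<close>, which is regrouped by total degree. Both
  multiplicativity of \<open>fps_at\<close> and the exponential law rest on this.\<close>

lemma sum_lessThan_mult_triangle:
  fixes a b :: "nat \<Rightarrow> 'a::ring"
  assumes "\<And>i j. N \<le> i + j \<Longrightarrow> a i * b j = 0"
  shows "(\<Sum>i<N. a i) * (\<Sum>j<N. b j) = (\<Sum>k<N. \<Sum>i\<le>k. a i * b (k - i))"
proof -
  have "(\<Sum>i<N. a i) * (\<Sum>j<N. b j) = (\<Sum>(i, j)\<in>{..<N} \<times> {..<N}. a i * b j)"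
    by (simp add: sum_product sum.cartesian_product)
  also have "\<dots> = (\<Sum>(i, j)\<in>{(i, j). i + j < N}. a i * b j)"
    by (rule sum.mono_neutral_right) (use assms not_le in auto)
  also have "\<dots> = (\<Sum>k<N. \<Sum>i\<le>k. a i * b (k - i))"
    by (rule sum.triangle_reindex)
  finally show ?thesis .
qed

lemma fps_at_diff: "fps_at (F - G) x = fps_at F x - fps_at G x"
  by (simp add: fps_at_def scaleR_diff_left sum_subtractf)

lemma fps_at_1: "nilpotent x \<Longrightarrow> fps_at 1 x = 1"
  \<comment> \<open>The bound is raised to a successor so that the constant term can be split off
    the sum.\<close>
  by (auto simp: nilpotent_def fps_at_eq[OF power_eq_0_mono, of x _ "Suc _", OF _ le_SucI[OF order.refl]]
      fps_one_def sum.lessThan_Suc_shift simp del: sum.lessThan_Suc power_Suc)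

lemma fps_at_X:
  assumes "nilpotent x"
  shows "fps_at fps_X x = x"
proof -
  obtain N where N: "x ^ N = 0"
    using assms by (auto simp: nilpotent_def)
  \<comment> \<open>A bound of at least 2 makes the indices 0 and 1 available for splitting off;
    only index 1 contributes.\<close>
  have "x ^ Suc (Suc N) = 0"
    by (simp add: N)
  then have "fps_at fps_X x = (\<Sum>n<Suc (Suc N). (fps_X $ n) *\<^sub>R x ^ n)"
    by (rule fps_at_eq)
  also have "\<dots> = x"
    by (simp add: sum.lessThan_Suc_shift del: sum.lessThan_Suc)
  finally show ?thesis .
qed

lemma fps_at_mult:
  assumes "nilpotent x"
  shows "fps_at (F * G) x = fps_at F x * fps_at G x"
proof -
  obtain N where N: "x ^ N = 0"
    using assms by (auto simp: nilpotent_def)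
  have "fps_at F x * fps_at G x = (\<Sum>k<N. \<Sum>i\<le>k. ((F $ i) *\<^sub>R x ^ i) * ((G $ (k - i)) *\<^sub>R x ^ (k - i)))"
    unfolding fps_at_eq[OF N]
    by (rule sum_lessThan_mult_triangle) (simp add: power_add[symmetric] power_eq_0_mono[OF N])
  also have "\<dots> = fps_at (F * G) x"
    by (simp add: fps_at_eq[OF N] fps_mult_nth scaleR_sum_left power_add[symmetric] atLeast0AtMost mult.commute)
  finally show ?thesis ..
qed

lemma fps_at_power: "nilpotent x \<Longrightarrow> fps_at (F ^ n) x = fps_at F x ^ n"
  by (induction n) (simp_all add: fps_at_1 fps_at_mult)

text \<open>A series without constant term has an \<open>N\<close>-th power starting in degree
  \<open>N\<close> or later, where all powers of \<open>x\<close> are zero.\<close>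

lemma nilpotent_fps_at:
  assumes "nilpotent x" "F $ 0 = 0"
  shows "nilpotent (fps_at F x)"
proof -
  obtain N where N: "x ^ N = 0"
    using assms by (auto simp: nilpotent_def)
  have "fps_at (F ^ N) x = 0"
    by (simp add: fps_at_eq[OF N] startsby_zero_power_prefix[OF assms(2)])
  then show ?thesis
    by (auto simp: nilpotent_def fps_at_power[OF assms(1)])
qed

text \<open>One bound \<open>N\<close> truncates everything: \<open>G ^ i\<close> has no terms below
  degree \<open>i\<close>, so \<open>fps_at G x\<close> is itself killed by the \<open>N\<close>-th
  power, and the two finite sums may be exchanged.\<close>

lemma fps_at_compose:
  assumes "nilpotent x" "G $ 0 = 0"
  shows "fps_at (F oo G) x = fps_at F (fps_at G x)"
proof -
  obtain N where N: "x ^ N = 0"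
    using assms by (auto simp: nilpotent_def)
  have prefix: "(G ^ i) $ n = 0" if "n < i" for n i
    using startsby_zero_power_prefix[OF assms(2)] that by blast
  have "fps_at G x ^ N = fps_at (G ^ N) x"
    by (simp add: fps_at_power[OF assms(1)])
  also have "\<dots> = 0"
    by (simp add: fps_at_eq[OF N] prefix)
  finally have "fps_at F (fps_at G x) = (\<Sum>i<N. (F $ i) *\<^sub>R fps_at (G ^ i) x)"
    by (simp add: fps_at_eq fps_at_power[OF assms(1)])
  also have "\<dots> = (\<Sum>n<N. \<Sum>i<N. (F $ i * (G ^ i) $ n) *\<^sub>R x ^ n)"
    by (subst sum.swap) (simp add: fps_at_eq[OF N] scaleR_sum_right)
  also have "\<dots> = (\<Sum>n<N. ((F oo G) $ n) *\<^sub>R x ^ n)"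
  proof (rule sum.cong[OF refl])
    fix n assume "n \<in> {..<N}"
    then have "(\<Sum>i<N. F $ i * (G ^ i) $ n) = (\<Sum>i=0..n. F $ i * (G ^ i) $ n)"
      by (intro sum.mono_neutral_right) (auto simp: prefix)
    then show "(\<Sum>i<N. (F $ i * (G ^ i) $ n) *\<^sub>R x ^ n) = ((F oo G) $ n) *\<^sub>R x ^ n"
      by (simp add: fps_compose_nth scaleR_sum_left[symmetric])
  qed
  finally show ?thesis
    by (simp add: fps_at_eq[OF N])
qed

lemma power_intertwine: "x * b = b * (y :: 'a::monoid_mult) \<Longrightarrow> x ^ n * b = b * y ^ n"
  by (induction n) (simp_all add: power_Suc2 mult.assoc del: power_Suc, simp add: mult.assoc[symmetric])

text \<open>The relation passes to every power and hence to the truncated series. With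
  \<open>y = x\<close> it says that whatever commutes with \<open>x\<close> commutes with a series
  in \<open>x\<close>; with \<open>y\<close> different from \<open>x\<close> it moves the twist past
  other operators.\<close>

lemma fps_at_intertwine:
  assumes "nilpotent x" "nilpotent y" "x * b = b * y"
  shows "fps_at F x * b = b * fps_at F y"
proof -
  obtain M N where MN: "x ^ M = 0" "y ^ N = 0"
    using assms by (auto simp: nilpotent_def)
  have "x ^ (M + N) = 0" "y ^ (M + N) = 0"
    by (auto intro: power_eq_0_mono[OF MN(1)] power_eq_0_mono[OF MN(2)])
  then show ?thesis
    by (simp add: fps_at_eq sum_distrib_left sum_distrib_right power_intertwine[OF assms(3)])
qed

section \<open>Commuting nilpotents: binomial theorem, exponential law, logarithm\<close>

lemma power_mult_distrib_commuting:
  fixes x y :: "'a::monoid_mult"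
  assumes "x * y = y * x"
  shows "(x * y) ^ n = x ^ n * y ^ n"
proof (induction n)
  case (Suc n)
  have "(x * y) ^ Suc n = x * (y * x ^ n) * y ^ n"
    by (simp add: Suc mult.assoc)
  also have "y * x ^ n = x ^ n * y"
    using power_commuting_commutes[OF assms] by simp
  finally show ?case
    by (simp add: mult.assoc)
qed simp

lemma nilpotent_mult_commuting:
  "x * y = y * x \<Longrightarrow> nilpotent y \<Longrightarrow> nilpotent (x * y)"
  by (metis mult_zero_right nilpotent_def power_mult_distrib_commuting)

lemma binomial_commuting:
  fixes x y :: "'a::real_algebra_1"
  assumes comm: "x * y = y * x"
  shows "(x + y) ^ n = (\<Sum>k\<le>n. real (n choose k) *\<^sub>R (x ^ k * y ^ (n - k)))"
proof (induction n)
  case (Suc n)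
  have y: "y * (x ^ k * y ^ (n - k)) = x ^ k * y ^ (Suc n - k)" if "k \<le> n" for k
    using that power_commuting_commutes[OF comm, of k] by (simp add: Suc_diff_le) (metis mult.assoc)
  \<comment> \<open>The added term \<open>k = Suc n\<close> has binomial coefficient zero; with it
    the index can be shifted so that Pascal's rule applies termwise.\<close>
  have "(\<Sum>k\<le>n. real (n choose k) *\<^sub>R (x ^ k * y ^ (Suc n - k)))
      = (\<Sum>k\<le>Suc n. real (n choose k) *\<^sub>R (x ^ k * y ^ (Suc n - k)))"
    by (simp add: binomial_eq_0)
  also have "\<dots> = y ^ Suc n + (\<Sum>k\<le>n. real (n choose Suc k) *\<^sub>R (x ^ Suc k * y ^ (n - k)))"
    by (subst sum.atMost_Suc_shift) simp
  finally have shifted: "(\<Sum>k\<le>n. real (n choose k) *\<^sub>R (x ^ k * y ^ (Suc n - k)))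
      = y ^ Suc n + (\<Sum>k\<le>n. real (n choose Suc k) *\<^sub>R (x ^ Suc k * y ^ (n - k)))" .
  have "(x + y) ^ Suc n = (\<Sum>k\<le>n. real (n choose k) *\<^sub>R (x ^ Suc k * y ^ (n - k)))
      + (\<Sum>k\<le>n. real (n choose k) *\<^sub>R (x ^ k * y ^ (Suc n - k)))"
    unfolding power_Suc[of "x + y"] Suc distrib_right sum_distrib_left sum.distrib
    by (intro arg_cong2[of _ _ _ _ "(+)"] sum.cong refl) (simp_all add: y mult.assoc)
  also have "\<dots> = (\<Sum>k\<le>Suc n. real (Suc n choose k) *\<^sub>R (x ^ k * y ^ (Suc n - k)))"
    unfolding shifted
    by (subst sum.atMost_Suc_shift) (simp add: scaleR_add_left sum.distrib)
  finally show ?case .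
qed simp

lemma scaled_binomial_commuting:
  fixes x y :: "'a::real_algebra_1"
  assumes comm: "x * y = y * x"
  shows "(x + y) ^ n /\<^sub>R fact n = (\<Sum>i\<le>n. (x ^ i /\<^sub>R fact i) * (y ^ (n - i) /\<^sub>R fact (n - i)))"
  unfolding binomial_commuting[OF comm] scaleR_sum_right
proof (rule sum.cong[OF refl])
  fix k assume "k \<in> {..n}"
  then have "real (n choose k) / fact n = inverse (fact k) * inverse (fact (n - k))"
    by (simp add: binomial_fact field_simps)
  then show "(real (n choose k) *\<^sub>R (x ^ k * y ^ (n - k))) /\<^sub>R fact n
      = (x ^ k /\<^sub>R fact k) * (y ^ (n - k) /\<^sub>R fact (n - k))"
    by (simp add: divide_inverse mult.commute)
qed

text \<open>In degree \<open>M + N\<close> every binomial term contains at least \<open>M\<close>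
  factors \<open>x\<close> or at least \<open>N\<close> factors \<open>y\<close>.\<close>

lemma nilpotent_add_commuting:
  fixes x y :: "'a::real_algebra_1"
  assumes "x * y = y * x" "nilpotent x" "nilpotent y"
  shows "nilpotent (x + y)"
proof -
  obtain M N where MN: "x ^ M = 0" "y ^ N = 0"
    using assms by (auto simp: nilpotent_def)
  have "x ^ i = 0 \<or> y ^ (M + N - i) = 0" for i
    using power_eq_0_mono[OF MN(1), of i] power_eq_0_mono[OF MN(2), of "M + N - i"] by linarith
  then have "(x ^ i /\<^sub>R fact i) * (y ^ (M + N - i) /\<^sub>R fact (M + N - i)) = 0" for i
    by (metis mult_zero_left mult_zero_right scaleR_zero_right)
  then have "(x + y) ^ (M + N) /\<^sub>R fact (M + N) = 0"
    unfolding scaled_binomial_commuting[OF assms(1)] by (simp only: sum.neutral_const)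
  then show ?thesis
    by (auto simp: nilpotent_def)
qed

abbreviation nexp :: "'a::real_algebra_1 \<Rightarrow> 'a" where
  "nexp \<equiv> fps_at (fps_exp 1)"

lemma nexp_add:
  assumes "x * y = y * x" "nilpotent x" "nilpotent y"
  shows "nexp (x + y) = nexp x * nexp y"
proof -
  obtain L M N where LMN: "x ^ M = 0" "y ^ N = 0" "(x + y) ^ L = 0"
    using assms nilpotent_add_commuting[OF assms] by (auto simp: nilpotent_def)
  \<comment> \<open>Large enough that all three powers vanish and that \<open>i + j\<close> at least
    \<open>K\<close> forces \<open>i\<close> to reach \<open>M\<close> or \<open>j\<close> to reach
    \<open>N\<close>.\<close>
  define K where "K = L + M + N"
  have K: "x ^ K = 0" "y ^ K = 0" "(x + y) ^ K = 0"
    unfolding K_def by (auto intro: power_eq_0_mono[OF LMN(1)] power_eq_0_mono[OF LMN(2)] power_eq_0_mono[OF LMN(3)])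
  have "nexp x * nexp y = (\<Sum>k<K. \<Sum>i\<le>k. (x ^ i /\<^sub>R fact i) * (y ^ (k - i) /\<^sub>R fact (k - i)))"
    unfolding fps_at_eq[OF K(1)] fps_at_eq[OF K(2)] fps_exp_nth power_one inverse_eq_divide[symmetric] of_nat_fact
  proof (rule sum_lessThan_mult_triangle)
    fix i j assume "K \<le> i + j"
    then have "x ^ i = 0 \<or> y ^ j = 0"
      using power_eq_0_mono[OF LMN(1), of i] power_eq_0_mono[OF LMN(2), of j] unfolding K_def by linarith
    then show "(x ^ i /\<^sub>R fact i) * (y ^ j /\<^sub>R fact j) = 0"
      by auto
  qed
  also have "\<dots> = (\<Sum>k<K. (x + y) ^ k /\<^sub>R fact k)"
    by (simp only: scaled_binomial_commuting[OF assms(1), symmetric])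
  also have "\<dots> = nexp (x + y)"
    by (simp add: fps_at_eq[OF K(3)] divide_inverse)
  finally show ?thesis ..
qed

lemma nexp_0: "nexp 0 = 1"
  using fps_at_eq[of 0 1 "fps_exp 1"] by simp

lemma nilpotent_scaleR: "nilpotent x \<Longrightarrow> nilpotent (r *\<^sub>R (x :: 'a::real_algebra_1))"
  using nilpotent_mult_commuting[of "r *\<^sub>R 1" x] by simp

lemma nilpotent_minus: "nilpotent x \<Longrightarrow> nilpotent (- (x :: 'a::real_algebra_1))"
  using nilpotent_scaleR[of x "-1"] by simp

lemma nexp_minus:
  assumes "nilpotent x"
  shows "nexp x * nexp (- x) = 1" "nexp (- x) * nexp x = 1"
  using nexp_add[of x "- x"] nexp_add[of "- x" x] assms by (auto simp: nilpotent_minus nexp_0)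

text \<open>As formal series, \<open>fps_ln 1\<close> stands for ln(1 + X) and is the compositional
  inverse of \<open>fps_exp 1 - 1\<close>; evaluation at a nilpotent element respects
  composition.\<close>

lemma nexp_fps_ln:
  assumes "nilpotent x"
  shows "nexp (fps_at (fps_ln 1) x) = 1 + x"
proof -
  have "nexp (fps_at (fps_ln 1) x) - 1 = fps_at ((fps_exp 1 - 1) oo fps_ln 1) x"
    using assms by (simp add: fps_at_compose fps_at_diff fps_at_1 nilpotent_fps_at)
  also have "(fps_exp 1 - 1) oo fps_ln 1 = (fps_X :: real fps)"
    by (simp only: fps_ln_fps_exp_inv[OF one_neq_zero]) (rule fps_inv_right; simp)
  finally show ?thesis
    using assms by (simp add: fps_at_X algebra_simps)
qed

lemma fps_ln_nexp:
  assumes "nilpotent x"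
  shows "fps_at (fps_ln 1) (nexp x - 1) = x"
proof -
  have "fps_at (fps_ln 1) (nexp x - 1) = fps_at (fps_ln 1 oo (fps_exp 1 - 1)) x"
    using assms by (simp add: fps_at_compose fps_at_diff fps_at_1)
  also have "fps_ln 1 oo (fps_exp 1 - 1) = (fps_X :: real fps)"
    by (simp only: fps_ln_fps_exp_inv[OF one_neq_zero]) (rule fps_inv; simp)
  finally show ?thesis
    using assms by (simp add: fps_at_X)
qed

subsection \<open>The algebra of row-finite operators\<close>

text \<open>On functions over an infinite label set, linear operators acting on different tensor factors
  need not commute; they do if each output coordinate depends on finitely many input coordinates.\<close>

definition row_finite :: "'i operator \<Rightarrow> bool" where
  "row_finite X \<longleftrightarrow>
    (\<forall>v w. X (\<lambda>k. v k + w k) = (\<lambda>k. X v k + X w k)) \<and>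
    (\<forall>c v. X (\<lambda>k. c * v k) = (\<lambda>k. c * X v k)) \<and>
    (\<forall>i. \<exists>S. finite S \<and> (\<forall>v w. (\<forall>k\<in>S. v k = w k) \<longrightarrow> X v i = X w i))"

lemma row_finite_add: "row_finite X \<Longrightarrow> X (\<lambda>k. v k + w k) i = X v i + X w i"
  by (simp add: row_finite_def)

lemma row_finite_scale: "row_finite X \<Longrightarrow> X (\<lambda>k. c * v k) i = c * X v i"
  by (simp add: row_finite_def)

lemma row_finite_local:
  assumes "row_finite X"
  obtains S where "finite S" "\<And>v w. (\<And>k. k \<in> S \<Longrightarrow> v k = w k) \<Longrightarrow> X v i = X w i"
  using assms unfolding row_finite_def by metis

lemma row_finiteI:
  assumes "\<And>v w i. X (\<lambda>k. v k + w k) i = X v i + X w i"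
    and "\<And>c v i. X (\<lambda>k. c * v k) i = c * X v i"
    and "\<And>i. \<exists>S. finite S \<and> (\<forall>v w. (\<forall>k\<in>S. v k = w k) \<longrightarrow> X v i = X w i)"
  shows "row_finite X"
  unfolding row_finite_def using assms by blast

lemma row_finite_sum:
  assumes "row_finite X"
  shows "X (\<lambda>k. \<Sum>a\<in>A. v a k) i = (\<Sum>a\<in>A. X (v a) i)"
proof -
  have "X (\<lambda>k. 0) i = 0"
    using row_finite_scale[OF assms, of 0 "\<lambda>_. 0"] by simp
  then show ?thesis
    by (induction A rule: infinite_finite_induct) (simp_all add: row_finite_add[OF assms])
qed

text \<open>A coordinate of \<open>X v\<close> is a finite linear combination of coordinates of
  \<open>v\<close>, and the linear operator \<open>Y\<close> passes through such a
  combination.\<close>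

lemma row_finite_commute:
  assumes X: "row_finite X" and Y: "row_finite Y"
  shows "X (\<lambda>k. Y (v k) j) i = Y (\<lambda>l. X (\<lambda>k. v k l) i) j"
proof -
  obtain S where S: "finite S" "\<And>v w. (\<And>k. k \<in> S \<Longrightarrow> v k = w k) \<Longrightarrow> X v i = X w i"
    using row_finite_local[OF X] by metis
  have expand: "X v i = (\<Sum>k\<in>S. X (basis_vec k) i * v k)" for v
  proof -
    have "X v i = X (\<lambda>l. \<Sum>k\<in>S. v k * basis_vec k l) i"
      using S(1) by (intro S(2)) (simp add: basis_vec_def if_distrib cong: if_cong)
    also have "\<dots> = (\<Sum>k\<in>S. X (basis_vec k) i * v k)"
      by (simp add: row_finite_sum[OF X] row_finite_scale[OF X] mult.commute)
    finally show ?thesis .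
  qed
  have "X (\<lambda>k. Y (v k) j) i = (\<Sum>k\<in>S. X (basis_vec k) i * Y (v k) j)"
    by (rule expand)
  also have "\<dots> = Y (\<lambda>l. \<Sum>k\<in>S. X (basis_vec k) i * v k l) j"
    by (simp add: row_finite_sum[OF Y] row_finite_scale[OF Y])
  also have "\<dots> = Y (\<lambda>l. X (\<lambda>k. v k l) i) j"
    by (simp add: expand[symmetric])
  finally show ?thesis .
qed

text \<open>A type of its own allows an instance of \<open>real_algebra_1\<close>, with composition
  as product, so that all facts about power series at nilpotent elements apply to operators.\<close>

typedef 'i rop = "{X :: 'i operator. row_finite X}" morphisms app Rop
proof
  show "(\<lambda>v i. 0) \<in> {X :: 'i operator. row_finite X}"
    by (auto intro!: row_finiteI)
qed

setup_lifting type_definition_rop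

instantiation rop :: (type) real_algebra_1
begin

lift_definition zero_rop :: "'a rop" is "\<lambda>v i. 0"
  by (auto intro!: row_finiteI)

lift_definition one_rop :: "'a rop" is "\<lambda>v. v"
  by (rule row_finiteI) (auto intro: exI[of _ "{_}"])

lift_definition plus_rop :: "'a rop \<Rightarrow> 'a rop \<Rightarrow> 'a rop" is "\<lambda>X Y v i. X v i + Y v i"
proof -
  fix X Y :: "'a operator" assume XY: "row_finite X" "row_finite Y"
  show "row_finite (\<lambda>v i. X v i + Y v i)"
  proof (rule row_finiteI)
    fix i
    obtain S T where "finite S" "\<And>v w. (\<And>k. k \<in> S \<Longrightarrow> v k = w k) \<Longrightarrow> X v i = X w i"
      "finite T" "\<And>v w. (\<And>k. k \<in> T \<Longrightarrow> v k = w k) \<Longrightarrow> Y v i = Y w i"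
      using XY row_finite_local by metis
    then show "\<exists>S. finite S \<and> (\<forall>v w. (\<forall>k\<in>S. v k = w k) \<longrightarrow> X v i + Y v i = X w i + Y w i)"
      by (intro exI[of _ "S \<union> T"]) (metis UnCI finite_UnI)
  qed (simp_all add: XY row_finite_add row_finite_scale algebra_simps)
qed

lift_definition uminus_rop :: "'a rop \<Rightarrow> 'a rop" is "\<lambda>X v i. - X v i"
  by (rule row_finiteI) (simp_all add: row_finite_add row_finite_scale, metis row_finite_local)

definition minus_rop :: "'a rop \<Rightarrow> 'a rop \<Rightarrow> 'a rop" where
  "minus_rop X Y = X + - Y"

lift_definition scaleR_rop :: "real \<Rightarrow> 'a rop \<Rightarrow> 'a rop" is "\<lambda>r X v i. of_real r * X v i"
  by (rule row_finiteI) (simp_all add: row_finite_add row_finite_scale algebra_simps, metis row_finite_local)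

lift_definition times_rop :: "'a rop \<Rightarrow> 'a rop \<Rightarrow> 'a rop" is "\<lambda>X Y v. X (Y v)"
proof -
  fix X Y :: "'a operator" assume XY: "row_finite X" "row_finite Y"
  show "row_finite (\<lambda>v. X (Y v))"
  proof (rule row_finiteI)
    fix i
    obtain S where S: "finite S" "\<And>v w. (\<And>k. k \<in> S \<Longrightarrow> v k = w k) \<Longrightarrow> X v i = X w i"
      using XY(1) row_finite_local by metis
    \<comment> \<open>Each of the finitely many coordinates \<open>k\<close> of \<open>Y v\<close>
      read by \<open>X\<close> reads in turn a finite set \<open>T k\<close>; the union of these
      sets determines the result.\<close>
    have "\<forall>k. \<exists>S. finite S \<and> (\<forall>v w. (\<forall>l\<in>S. v l = w l) \<longrightarrow> Y v k = Y w k)"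
      using XY(2) unfolding row_finite_def by blast
    from choice[OF this] obtain T
      where T: "\<forall>k. finite (T k) \<and> (\<forall>v w. (\<forall>l\<in>T k. v l = w l) \<longrightarrow> Y v k = Y w k)"
      by (rule exE)
    have "X (Y v) i = X (Y w) i" if "\<forall>k\<in>(\<Union>k\<in>S. T k). v k = w k" for v w
      by (rule S(2)) (use T that in simp)
    moreover have "finite (\<Union>k\<in>S. T k)"
      using S(1) T by simp
    ultimately show "\<exists>S. finite S \<and> (\<forall>v w. (\<forall>k\<in>S. v k = w k) \<longrightarrow> X (Y v) i = X (Y w) i)"
      by (intro exI conjI allI impI)
  qed (use XY in \<open>simp_all add: row_finite_def\<close>)
qed

instance
proof
  fix X Y Z :: "'a rop" and r s :: real
  show "0 \<noteq> (1 :: 'a rop)"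
    by transfer (auto simp: fun_eq_iff intro: exI[of _ "\<lambda>_. 1"])
  show "X - Y = X + - Y"
    by (rule minus_rop_def)
qed (transfer; simp add: fun_eq_iff algebra_simps row_finite_add row_finite_scale)+

end

text \<open>The algebra is taken over the reals while \<open>h\<close> is complex, so complex
  scalars enter as central elements.\<close>

lift_definition scal :: "complex \<Rightarrow> 'i rop" is "\<lambda>c v k. c * v k"
  unfolding row_finite_def by (intro conjI allI exI[of _ "{_}"]) (auto simp: algebra_simps)

lift_definition on_fst :: "'i rop \<Rightarrow> ('i \<times> 'j) rop" is "\<lambda>X v (i, j). X (\<lambda>i'. v (i', j)) i"
proof -
  fix X :: "'i operator" assume X: "row_finite X"
  show "row_finite (\<lambda>v (i :: 'i, j :: 'j). X (\<lambda>i'. v (i', j)) i)"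
  proof (rule row_finiteI)
    fix p :: "'i \<times> 'j"
    obtain S where S: "finite S" "\<And>v w. (\<And>k. k \<in> S \<Longrightarrow> v k = w k) \<Longrightarrow> X v (fst p) = X w (fst p)"
      using row_finite_local[OF X] by metis
    then show "\<exists>S. finite S \<and> (\<forall>v w. (\<forall>k\<in>S. v k = w k) \<longrightarrow>
        (case p of (i, j) \<Rightarrow> X (\<lambda>i'. v (i', j)) i) = (case p of (i, j) \<Rightarrow> X (\<lambda>i'. w (i', j)) i))"
      unfolding case_prod_unfold
      by (intro exI[of _ "S \<times> {snd p}"] conjI allI impI S(2)) simp_all
  qed (simp_all add: case_prod_unfold row_finite_add[OF X] row_finite_scale[OF X])
qed

lift_definition on_snd :: "'j rop \<Rightarrow> ('i \<times> 'j) rop" is "\<lambda>Y v (i, j). Y (\<lambda>j'. v (i, j')) j"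
proof -
  fix Y :: "'j operator" assume Y: "row_finite Y"
  show "row_finite (\<lambda>v (i :: 'i, j :: 'j). Y (\<lambda>j'. v (i, j')) j)"
  proof (rule row_finiteI)
    fix p :: "'i \<times> 'j"
    obtain S where S: "finite S" "\<And>v w. (\<And>k. k \<in> S \<Longrightarrow> v k = w k) \<Longrightarrow> Y v (snd p) = Y w (snd p)"
      using row_finite_local[OF Y] by metis
    then show "\<exists>S. finite S \<and> (\<forall>v w. (\<forall>k\<in>S. v k = w k) \<longrightarrow>
        (case p of (i, j) \<Rightarrow> Y (\<lambda>j'. v (i, j')) j) = (case p of (i, j) \<Rightarrow> Y (\<lambda>j'. w (i, j')) j))"
      unfolding case_prod_unfold
      by (intro exI[of _ "{fst p} \<times> S"] conjI allI impI S(2)) simp_all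
  qed (simp_all add: case_prod_unfold row_finite_add[OF Y] row_finite_scale[OF Y])
qed

text \<open>Transport of operators along the componentwise identification of the two
  bracketings.\<close>

lift_definition reassoc :: "(('i \<times> 'j) \<times> 'k) rop \<Rightarrow> ('i \<times> ('j \<times> 'k)) rop" is
  "\<lambda>X v (i, j, k). X (\<lambda>((i', j'), k'). v (i', j', k')) ((i, j), k)"
proof -
  fix X :: "(('i \<times> 'j) \<times> 'k) operator" assume X: "row_finite X"
  show "row_finite (\<lambda>v (i, j, k). X (\<lambda>((i', j'), k'). v (i', j', k')) ((i, j), k))"
  proof (rule row_finiteI)
    fix p :: "'i \<times> 'j \<times> 'k"
    obtain i j k where p: "p = (i, j, k)"
      by (cases p)
    obtain S where S: "finite S"
      "\<And>v w. (\<And>l. l \<in> S \<Longrightarrow> v l = w l) \<Longrightarrow> X v ((i, j), k) = X w ((i, j), k)"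
      using row_finite_local[OF X] by metis
    have "finite ((\<lambda>((i, j), k). (i, j, k)) ` S)"
      using S(1) by simp
    moreover have "X (\<lambda>((i', j'), k'). v (i', j', k')) ((i, j), k)
        = X (\<lambda>((i', j'), k'). w (i', j', k')) ((i, j), k)"
      if "\<forall>l\<in>(\<lambda>((i, j), k). (i, j, k)) ` S. v l = w l" for v w
      by (rule S(2)) (use that in force)
    ultimately show "\<exists>S. finite S \<and> (\<forall>v w. (\<forall>k\<in>S. v k = w k) \<longrightarrow>
        (case p of (i, j, k) \<Rightarrow> X (\<lambda>((i', j'), k'). v (i', j', k')) ((i, j), k)) =
        (case p of (i, j, k) \<Rightarrow> X (\<lambda>((i', j'), k'). w (i', j', k')) ((i, j), k)))"
      unfolding p prod.case by blast
  qed (simp_all add: case_prod_unfold row_finite_add[OF X] row_finite_scale[OF X])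
qed

section \<open>Algebra homomorphisms: tensor legs and rebracketing\<close>

definition alg_hom :: "('a::real_algebra_1 \<Rightarrow> 'b::real_algebra_1) \<Rightarrow> bool" where
  "alg_hom \<phi> \<longleftrightarrow> linear \<phi> \<and> \<phi> 1 = 1 \<and> (\<forall>x y. \<phi> (x * y) = \<phi> x * \<phi> y)"

lemma alg_homD:
  assumes "alg_hom \<phi>"
  shows "\<phi> 1 = 1" "\<phi> (x * y) = \<phi> x * \<phi> y" "\<phi> (x + y) = \<phi> x + \<phi> y" "\<phi> (x - y) = \<phi> x - \<phi> y"
    "\<phi> (- x) = - \<phi> x" "\<phi> (r *\<^sub>R x) = r *\<^sub>R \<phi> x" "\<phi> 0 = 0"
  using assms by (auto simp: alg_hom_def linear_add linear_diff linear_neg linear_scale linear_0)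

lemma alg_hom_power: "alg_hom \<phi> \<Longrightarrow> \<phi> (x ^ n) = \<phi> x ^ n"
  by (induction n) (simp_all add: alg_homD)

lemma alg_hom_nilpotent: "alg_hom \<phi> \<Longrightarrow> nilpotent x \<Longrightarrow> nilpotent (\<phi> x)"
  unfolding nilpotent_def by (metis alg_hom_power alg_homD(7))

text \<open>Lets the tensor legs and the rebracketing act directly on the exponent of a
  twist.\<close>

lemma alg_hom_fps_at:
  assumes "alg_hom \<phi>" "nilpotent x"
  shows "\<phi> (fps_at F x) = fps_at F (\<phi> x)"
proof -
  obtain N where N: "x ^ N = 0"
    using assms by (auto simp: nilpotent_def)
  then have "\<phi> x ^ N = 0"
    using alg_hom_power[OF assms(1)] alg_homD(7)[OF assms(1)] by metis
  then show ?thesis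
    using assms(1) N
    by (simp add: fps_at_eq linear_sum[of \<phi>] alg_hom_def alg_hom_power[OF assms(1)] linear_scale)
qed

lemma alg_hom_on_fst: "alg_hom on_fst"
  unfolding alg_hom_def linear_iff by (intro conjI allI; transfer; simp add: fun_eq_iff)

lemma alg_hom_on_snd: "alg_hom on_snd"
  unfolding alg_hom_def linear_iff by (intro conjI allI; transfer; simp add: fun_eq_iff)

lemma alg_hom_reassoc: "alg_hom reassoc"
  unfolding alg_hom_def linear_iff
  by (intro conjI allI; transfer; simp add: fun_eq_iff case_prod_unfold)

lemmas on_fst_simps = alg_homD[OF alg_hom_on_fst]
lemmas on_snd_simps = alg_homD[OF alg_hom_on_snd]

lemma on_fst_on_snd_commute: "on_snd Y * on_fst X = on_fst X * on_snd Y"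
  by transfer (clarsimp simp: fun_eq_iff, rule row_finite_commute)

lemma on_fst_on_snd_left_commute: "on_snd Y * (on_fst X * Z) = on_fst X * (on_snd Y * Z)"
  by (simp add: on_fst_on_snd_commute flip: mult.assoc)

lemma reassoc_simps:
  "reassoc (on_fst (on_fst X)) = on_fst X"
  "reassoc (on_fst (on_snd Y)) = on_snd (on_fst Y)"
  "reassoc (on_snd Z) = on_snd (on_snd Z)"
  by (transfer; simp add: fun_eq_iff)+

lemma scal_commute: "scal c * X = X * scal c"
  by transfer (simp add: fun_eq_iff row_finite_scale)

lemma on_fst_scal: "on_fst (scal c) = scal c"
  by transfer (simp add: fun_eq_iff)

lemma on_snd_scal: "on_snd (scal c) = scal c"
  by transfer (simp add: fun_eq_iff)

section \<open>Translating the operator series into the algebra\<close>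

lemma app_sum: "app (sum X A) v i = (\<Sum>a\<in>A. app (X a) v i)"
  by (induction A rule: infinite_finite_induct) (simp_all add: zero_rop.rep_eq plus_rop.rep_eq)

lemma app_1: "app 1 = id"
  by (simp add: fun_eq_iff one_rop.rep_eq)

lemma app_mult: "app (X * Y) = app X \<circ> app Y"
  by (simp add: fun_eq_iff times_rop.rep_eq)

lemma app_power: "app (X ^ n) = app X ^^ n"
  by (induction n) (simp_all add: app_1 app_mult)

lemma app_sum_right: "app X (\<lambda>k. \<Sum>a\<in>A. v a k) = (\<lambda>k. \<Sum>a\<in>A. app X (v a) k)"
  by (rule ext, rule row_finite_sum) (use app in auto)

lemma app_scale_right: "app X (\<lambda>k. c * v k) = (\<lambda>k. c * app X v k)"
  by (rule ext, rule row_finite_scale) (use app in auto)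

text \<open>Nilpotency cuts the infinite series off at a bound that is the same for all vectors and
  coordinates.\<close>

lemma op_exp_app:
  assumes "nilpotent X"
  shows "op_exp (app X) = app (nexp X)"
proof (intro ext)
  fix v i
  obtain N where N: "X ^ N = 0"
    using assms by (auto simp: nilpotent_def)
  have "op_exp (app X) v i = (\<Sum>n. app (X ^ n) v i / fact n)"
    by (simp add: op_exp_def app_power)
  also have "\<dots> = (\<Sum>n<N. app (X ^ n) v i / fact n)"
    by (rule suminf_finite) (auto simp: power_eq_0_mono[OF N] zero_rop.rep_eq)
  also have "\<dots> = app (nexp X) v i"
    by (simp add: fps_at_eq[OF N] app_sum scaleR_rop.rep_eq divide_inverse mult.commute)
  finally show "op_exp (app X) v i = app (nexp X) v i" .
qed

lemma op_ln_app:
  assumes "nilpotent X"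
  shows "op_ln (app (1 + X)) = app (fps_at (fps_ln 1) X)"
proof (intro ext)
  fix v i
  obtain N where N: "X ^ N = 0"
    using assms by (auto simp: nilpotent_def)
  \<comment> \<open>The Mercator term of index \<open>n\<close> carries the power
    \<open>Suc n\<close>, so \<open>N\<close> of its terms match the degrees 1 to \<open>N\<close>
    of \<open>fps_ln 1\<close>, whose constant term is zero.\<close>
  then have N': "X ^ Suc N = 0"
    by simp
  have "(\<lambda>w k. app (1 + X) w k - w k) = app X"
    by (simp add: fun_eq_iff plus_rop.rep_eq one_rop.rep_eq)
  then have "op_ln (app (1 + X)) v i = (\<Sum>n. (- 1) ^ n * app (X ^ Suc n) v i / of_nat (Suc n))"
    by (simp only: op_ln_def app_power)
  also have "\<dots> = (\<Sum>n<N. (- 1) ^ n * app (X ^ Suc n) v i / of_nat (Suc n))"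
    by (rule suminf_finite) (auto simp: power_eq_0_mono[OF N] zero_rop.rep_eq)
  also have "\<dots> = app (fps_at (fps_ln 1) X) v i"
    by (simp add: fps_at_eq[OF N'] sum.lessThan_Suc_shift app_sum plus_rop.rep_eq scaleR_rop.rep_eq
        fps_ln_nth divide_inverse ac_simps del: sum.lessThan_Suc power_Suc)
  finally show "op_ln (app (1 + X)) v i = app (fps_at (fps_ln 1) X) v i" .
qed

lemma op_tensor_app: "app X \<otimes> app Y = app (on_fst X * on_snd Y)"
  by (auto simp: fun_eq_iff op_tensor_def times_rop.rep_eq on_fst.rep_eq on_snd.rep_eq)

lemma app_tensor_id: "app X \<otimes> id = app (on_fst X)"
  by (auto simp: fun_eq_iff op_tensor_def on_fst.rep_eq)

lemma id_tensor_app: "id \<otimes> app Y = app (on_snd Y)"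
  by (auto simp: fun_eq_iff op_tensor_def on_snd.rep_eq)

text \<open>Replaces the function inverse \<open>inv\<close> in \<open>tensor_rep\<close> by an
  element of the algebra.\<close>

lemma inv_app:
  assumes "X * Y = 1" "Y * X = 1"
  shows "inv (app X) = app Y"
  by (rule inv_unique_comp) (simp_all add: assms app_1 flip: app_mult)

subsection \<open>The twist and its cocycle identity\<close>

text \<open>Since \<open>fps_ln 1\<close> is the series of ln(1 + X), evaluating it at
  \<open>- x\<close> gives ln(1 - x).\<close>

definition rop_sigma :: "'i rop \<Rightarrow> 'i rop" where
  "rop_sigma x = - fps_at (fps_ln 1) (- x)"

definition rop_twist :: "'i rop \<Rightarrow> 'j rop \<Rightarrow> ('i \<times> 'j) rop" where
  "rop_twist z x = nexp ((- 1 / 2) *\<^sub>R (on_fst z * on_snd (rop_sigma x)))"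

definition rop_twist_inv :: "'i rop \<Rightarrow> 'j rop \<Rightarrow> ('i \<times> 'j) rop" where
  "rop_twist_inv z x = nexp (- ((- 1 / 2) *\<^sub>R (on_fst z * on_snd (rop_sigma x))))"

text \<open>Here \<open>z\<close> stands for \<open>J\<^sub>0\<close> and \<open>x\<close> for \<open>2 h J\<^sub>+\<close>, the only combination through which \<open>J\<^sub>+\<close> enters the
  twist; thus \<open>[J\<^sub>0, J\<^sub>+] = 2 J\<^sub>+\<close> becomes \<open>z * x = x * z + 2 *\<^sub>R x\<close>.\<close>

definition represents :: "complex \<Rightarrow> 'i sl2_rep \<Rightarrow> 'i rop \<Rightarrow> 'i rop \<Rightarrow> bool" where
  "represents h R z x \<longleftrightarrow>
    nilpotent x \<and> Jzero R = app z \<and> (\<exists>p. Jplus R = app p \<and> x = scal (2 * h) * p)"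

lemma nilpotent_rop_sigma: "nilpotent x \<Longrightarrow> nilpotent (rop_sigma x)"
  by (simp add: rop_sigma_def nilpotent_minus nilpotent_fps_at)

lemma nexp_rop_sigma: "nilpotent x \<Longrightarrow> nexp (- rop_sigma x) = 1 - x"
  by (simp add: rop_sigma_def nilpotent_minus nexp_fps_ln)

lemma nilpotent_on_fst_on_snd: "nilpotent x \<Longrightarrow> nilpotent (r *\<^sub>R (on_fst z * on_snd x))"
  by (intro nilpotent_scaleR nilpotent_mult_commuting on_fst_on_snd_commute[symmetric]
      alg_hom_nilpotent[OF alg_hom_on_snd])

lemma rop_twist_inverse:
  assumes "nilpotent x"
  shows "rop_twist z x * rop_twist_inv z x = 1" "rop_twist_inv z x * rop_twist z x = 1"
  using nexp_minus[OF nilpotent_on_fst_on_snd[OF nilpotent_rop_sigma[OF assms]]]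
  unfolding rop_twist_def rop_twist_inv_def by metis+

text \<open>Moving \<open>on_fst y\<close> through the exponent replaces \<open>z\<close> by
  \<open>z + 2\<close>, which with the factor -1/2 shifts the exponent by \<open>- on_snd s\<close>.
  Exponentiated, this shift is the factor exp(-\<sigma>) = 1 - x on the second leg.\<close>

lemma rop_twist_conjugation:
  fixes z y :: "'i rop" and x :: "'j rop"
  assumes x: "nilpotent x" and zy: "z * y = y * z + 2 *\<^sub>R y"
  shows "rop_twist z x * (on_fst y + on_snd x) * rop_twist_inv z x = on_fst y * on_snd (1 - x) + on_snd x"
proof -
  define s where "s = rop_sigma x"
  define A where "A = (- 1 / 2 :: real) *\<^sub>R (on_fst z * on_snd s)"
  have s: "nilpotent s"
    using x by (simp add: s_def nilpotent_rop_sigma)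
  have s': "nilpotent (- on_snd s)"
    by (intro nilpotent_minus alg_hom_nilpotent[OF alg_hom_on_snd] s)
  have A: "nilpotent A"
    unfolding A_def by (rule nilpotent_on_fst_on_snd[OF s])
  have As: "- on_snd s * A = A * - on_snd s"
    by (simp add: A_def) (simp add: mult.assoc on_fst_on_snd_left_commute on_fst_on_snd_commute)
  have sA: "nilpotent (- on_snd s + A)"
    by (rule nilpotent_add_commuting[OF As s' A])
  have "on_snd s * on_fst y = on_fst y * on_snd s"
    by (rule on_fst_on_snd_commute)
  then have "A * on_fst y = (- 1 / 2) *\<^sub>R (on_fst (z * y) * on_snd s)"
    by (simp add: A_def on_fst_simps mult.assoc)
  also have "\<dots> = on_fst y * (- on_snd s + A)"
    by (simp add: A_def zy on_fst_simps algebra_simps)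
  finally have "nexp A * on_fst y = on_fst y * nexp (- on_snd s + A)"
    by (rule fps_at_intertwine[OF A sA])
  also have "nexp (- on_snd s + A) = nexp (on_snd (- s)) * nexp A"
    using nexp_add[OF As s' A] by (simp add: on_snd_simps)
  also have "nexp (on_snd (- s)) = on_snd (1 - x)"
    using alg_hom_fps_at[OF alg_hom_on_snd nilpotent_minus[OF s], of "fps_exp 1"]
    unfolding s_def nexp_rop_sigma[OF x] by (rule sym)
  finally have 1: "rop_twist z x * on_fst y = on_fst y * on_snd (1 - x) * rop_twist z x"
    by (simp add: rop_twist_def A_def s_def mult.assoc)
  \<comment> \<open>\<open>rop_sigma x\<close> is a series in \<open>x\<close>; hence the whole
    twist commutes with \<open>on_snd x\<close>.\<close>
  have "x * rop_sigma x = rop_sigma x * x"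
    using fps_at_intertwine[of "- x" "- x" x "fps_ln 1"] nilpotent_minus[OF x]
    by (simp add: rop_sigma_def)
  then have "on_snd (rop_sigma x) * on_snd x = (on_snd x * on_snd (rop_sigma x) :: ('i \<times> 'j) rop)"
    by (simp flip: on_snd_simps)
  then have "A * on_snd x = on_snd x * A"
    by (simp add: A_def s_def mult.assoc on_fst_on_snd_left_commute)
  then have 2: "rop_twist z x * on_snd x = on_snd x * rop_twist z x"
    using fps_at_intertwine[OF A A] by (simp add: rop_twist_def A_def s_def)
  have "rop_twist z x * (on_fst y + on_snd x) = (on_fst y * on_snd (1 - x) + on_snd x) * rop_twist z x"
    by (simp only: distrib_left distrib_right 1 2)
  then show ?thesis
    by (simp add: mult.assoc rop_twist_inverse[OF x])
qed

text \<open>By the conjugation formula \<open>1 - t\<close> factors as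
  \<open>on_fst (1 - y) * on_snd (1 - x)\<close>: the element \<open>1 - x\<close> is group-like.
  Each factor is the exponential of minus a \<sigma>, the exponents commute, and the logarithm turns
  the product into a sum.\<close>

lemma
  fixes z y :: "'i rop" and x :: "'j rop"
  assumes x: "nilpotent x" and y: "nilpotent y" and zy: "z * y = y * z + 2 *\<^sub>R y"
  defines "t \<equiv> rop_twist z x * (on_fst y + on_snd x) * rop_twist_inv z x"
  shows nilpotent_twisted_coproduct: "nilpotent t"
    and rop_sigma_twisted_coproduct: "rop_sigma t = on_fst (rop_sigma y) + on_snd (rop_sigma x)"
proof -
  define u where "u = (- on_fst (rop_sigma y) :: ('i \<times> 'j) rop)"
  define v where "v = (- on_snd (rop_sigma x) :: ('i \<times> 'j) rop)"
  have u: "nilpotent u" "nexp u = on_fst (1 - y)"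
    using alg_hom_fps_at[OF alg_hom_on_fst nilpotent_minus[OF nilpotent_rop_sigma[OF y]], of "fps_exp 1", symmetric]
    unfolding u_def nexp_rop_sigma[OF y] on_fst_simps(5)
    by (simp_all only: nilpotent_minus nilpotent_rop_sigma[OF y] alg_hom_nilpotent[OF alg_hom_on_fst])
  have v: "nilpotent v" "nexp v = on_snd (1 - x)"
    using alg_hom_fps_at[OF alg_hom_on_snd nilpotent_minus[OF nilpotent_rop_sigma[OF x]], of "fps_exp 1", symmetric]
    unfolding v_def nexp_rop_sigma[OF x] on_snd_simps(5)
    by (simp_all only: nilpotent_minus nilpotent_rop_sigma[OF x] alg_hom_nilpotent[OF alg_hom_on_snd])
  have uv: "u * v = v * u"
    by (simp add: u_def v_def on_fst_on_snd_commute)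
  have n: "nilpotent (u + v)"
    by (rule nilpotent_add_commuting[OF uv u(1) v(1)])
  have "nexp (u + v) = 1 - t"
    unfolding nexp_add[OF uv u(1) v(1)] u(2) v(2) t_def rop_twist_conjugation[OF x zy]
    by (simp add: on_fst_simps on_snd_simps algebra_simps)
  then have t: "- t = nexp (u + v) - 1"
    by simp
  then have "- t = fps_at (fps_exp 1 - 1) (u + v)"
    by (simp add: fps_at_diff fps_at_1[OF n])
  then have "nilpotent (- t)"
    by (simp add: nilpotent_fps_at[OF n])
  then show "nilpotent t"
    using nilpotent_minus by fastforce
  show "rop_sigma t = on_fst (rop_sigma y) + on_snd (rop_sigma x)"
    unfolding rop_sigma_def[of t] t fps_ln_nexp[OF n] by (simp add: u_def v_def)
qed

lemma sigma_eq_app: "represents h R z x \<Longrightarrow> sigma h R = app (rop_sigma x)"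
proof -
  assume "represents h R z x"
  then obtain p where p: "Jplus R = app p" "x = scal (2 * h) * p" "nilpotent x"
    by (auto simp: represents_def)
  have "(\<lambda>w k. w k - 2 * h * Jplus R w k) = app (1 + - x)"
    by (simp add: p fun_eq_iff plus_rop.rep_eq one_rop.rep_eq uminus_rop.rep_eq times_rop.rep_eq
        scal.rep_eq del: add_uminus_conv_diff)
  then show ?thesis
    by (simp add: sigma_def op_ln_app nilpotent_minus p(3) rop_sigma_def fun_eq_iff uminus_rop.rep_eq
        del: add_uminus_conv_diff)
qed

lemma twist_eq_app:
  assumes "represents h R z y" "represents h S w x"
  shows "twist h R S = app (rop_twist z x)"
proof -
  have x: "nilpotent x" and z: "Jzero R = app z"
    using assms by (auto simp: represents_def)
  have "(\<lambda>v p. - (1 / 2) * (Jzero R \<otimes> sigma h S) v p)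
      = app ((- 1 / 2) *\<^sub>R (on_fst z * on_snd (rop_sigma x)))"
    by (simp only: z sigma_eq_app[OF assms(2)] op_tensor_app fun_eq_iff scaleR_rop.rep_eq) simp
  then show ?thesis
    unfolding twist_def rop_twist_def
    by (simp only: op_exp_app[OF nilpotent_on_fst_on_snd[OF nilpotent_rop_sigma[OF x]]])
qed

lemma primitive_coproduct_app: "primitive_coproduct (app X) (app Y) = app (on_fst X + on_snd Y)"
  by (simp add: primitive_coproduct_def app_tensor_id id_tensor_app fun_eq_iff plus_rop.rep_eq)

text \<open>The twisted tensor product again has the form required by \<open>represents\<close>, so
  twists can be nested on threefold products.\<close>

lemma represents_tensor_rep:
  assumes R: "represents h R z y" and S: "represents h S w x" and zy: "z * y = y * z + 2 *\<^sub>R y"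
  shows "represents h (tensor_rep h R S) (rop_twist z x * (on_fst z + on_snd w) * rop_twist_inv z x)
    (rop_twist z x * (on_fst y + on_snd x) * rop_twist_inv z x)"
proof -
  have x: "nilpotent x" "Jzero S = app w" and y: "nilpotent y" "Jzero R = app z"
    using R S by (auto simp: represents_def)
  obtain p q where p: "Jplus R = app p" "y = scal (2 * h) * p"
    and q: "Jplus S = app q" "x = scal (2 * h) * q"
    using R S by (auto simp: represents_def)
  have inv: "inv (twist h R S) = app (rop_twist_inv z x)"
    by (simp add: twist_eq_app[OF R S] inv_app rop_twist_inverse[OF x(1)])
  have "rop_twist z x * (on_fst y + on_snd x) * rop_twist_inv z x
      = rop_twist z x * scal (2 * h) * (on_fst p + on_snd q) * rop_twist_inv z x"
    by (simp add: p(2) q(2) on_fst_simps on_snd_simps on_fst_scal on_snd_scal distrib_left mult.assoc)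
  \<comment> \<open>Centrality brings the factor \<open>2 * h\<close> to the front, where
    \<open>represents\<close> expects it.\<close>
  also have "rop_twist z x * scal (2 * h) = scal (2 * h) * rop_twist z x"
    by (rule scal_commute[symmetric])
  finally have "rop_twist z x * (on_fst y + on_snd x) * rop_twist_inv z x
      = scal (2 * h) * (rop_twist z x * (on_fst p + on_snd q) * rop_twist_inv z x)"
    by (simp add: mult.assoc)
  then show ?thesis
    unfolding represents_def
    using nilpotent_twisted_coproduct[OF x(1) y(1) zy]
    by (auto simp: tensor_rep_def inv[unfolded twist_eq_app[OF R S]] twist_eq_app[OF R S] 
        primitive_coproduct_app x(2) y(2) p(1) q(1)
        app_mult intro!: exI[of _ "rop_twist z x * (on_fst p + on_snd q) * rop_twist_inv z x"])
qed

text \<open>Both sides equal \<open>\<F>\<^sub>1\<^sub>2 \<F>\<^sub>1\<^sub>3 \<F>\<^sub>2\<^sub>3\<close>: on the left because \<open>J\<^sub>0\<close> has a primitive undeformed coproduct, on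
  the right because \<open>\<sigma>\<close> has a primitive deformed one.\<close>

lemma twist_cocycle:
  fixes z1 :: "'i rop" and z2 x2 :: "'j rop" and x3 :: "'k rop"
  assumes x2: "nilpotent x2" and x3: "nilpotent x3" and zx: "z2 * x2 = x2 * z2 + 2 *\<^sub>R x2"
  shows "reassoc (rop_twist (rop_twist z1 x2 * (on_fst z1 + on_snd z2) * rop_twist_inv z1 x2) x3
      * on_fst (rop_twist z1 x2))
    = rop_twist z1 (rop_twist z2 x3 * (on_fst x2 + on_snd x3) * rop_twist_inv z2 x3) * on_snd (rop_twist z2 x3)"
proof -
  define c where "c = (- 1 / 2 :: real)"
  note rop_sigma = nilpotent_rop_sigma[OF x2] nilpotent_rop_sigma[OF x3]
  \<comment> \<open>The \<open>A\<close>'s are the exponents of the twists on two of the three legs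
    in the right bracketing; the \<open>B\<close>'s are their counterparts in the left one.\<close>
  define A12 :: "('i \<times> 'j \<times> 'k) rop" where "A12 = c *\<^sub>R (on_fst z1 * on_snd (on_fst (rop_sigma x2)))"
  define A13 :: "('i \<times> 'j \<times> 'k) rop" where "A13 = c *\<^sub>R (on_fst z1 * on_snd (on_snd (rop_sigma x3)))"
  define A23 :: "('i \<times> 'j \<times> 'k) rop" where
    "A23 = c *\<^sub>R (on_snd (on_fst z2) * on_snd (on_snd (rop_sigma x3)))"
  define B13 :: "(('i \<times> 'j) \<times> 'k) rop" where "B13 = c *\<^sub>R (on_fst (on_fst z1) * on_snd (rop_sigma x3))"
  define B23 :: "(('i \<times> 'j) \<times> 'k) rop" where "B23 = c *\<^sub>R (on_fst (on_snd z2) * on_snd (rop_sigma x3))"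
  have nB: "nilpotent B13" "nilpotent B23"
    unfolding B13_def B23_def by (simp_all add: nilpotent_on_fst_on_snd rop_sigma)
  have nA: "nilpotent A12" "nilpotent A13"
    unfolding A12_def A13_def
    by (simp_all add: nilpotent_on_fst_on_snd alg_hom_nilpotent alg_hom_on_fst alg_hom_on_snd rop_sigma)
  have n12: "nilpotent (c *\<^sub>R (on_fst z1 * on_snd (rop_sigma x2)))"
    and n23: "nilpotent (c *\<^sub>R (on_fst z2 * on_snd (rop_sigma x3)))"
    by (simp_all add: nilpotent_on_fst_on_snd rop_sigma)
  have commB: "B13 * B23 = B23 * B13"
  proof -
    have "on_fst (on_fst z1) * on_fst (on_snd z2) = (on_fst (on_snd z2) * on_fst (on_fst z1) :: (('i \<times> 'j) \<times> 'k) rop)"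
      by (simp add: on_fst_on_snd_commute flip: on_fst_simps)
    then show ?thesis
      by (simp add: B13_def B23_def mult.assoc on_fst_on_snd_left_commute) (simp flip: mult.assoc)
  qed
  have commA: "A12 * A13 = A13 * A12"
  proof -
    have "on_snd (on_fst (rop_sigma x2)) * on_snd (on_snd (rop_sigma x3))
        = (on_snd (on_snd (rop_sigma x3)) * on_snd (on_fst (rop_sigma x2)) :: ('i \<times> 'j \<times> 'k) rop)"
      by (simp add: on_fst_on_snd_commute flip: on_snd_simps)
    then show ?thesis
      by (simp add: A12_def A13_def) (simp add: mult.assoc on_fst_on_snd_left_commute on_fst_on_snd_commute)
  qed
  have reassocB: "reassoc B13 = A13" "reassoc B23 = A23"
    by (simp_all add: A13_def A23_def B13_def B23_def alg_homD[OF alg_hom_reassoc] reassoc_simps)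

  let ?F = "on_fst (rop_twist z1 x2) :: (('i \<times> 'j) \<times> 'k) rop"
  let ?Z = "rop_twist z1 x2 * (on_fst z1 + on_snd z2) * rop_twist_inv z1 x2"
  \<comment> \<open>The deformed coproduct of \<open>z\<close> is a conjugate by the twist, so
    passing \<open>?F\<close> leaves the primitive one, whose two summands give \<open>B13\<close>
    and \<open>B23\<close>.\<close>
  have Z: "on_fst ?Z * ?F = ?F * on_fst (on_fst z1 + on_snd z2)"
    by (simp add: mult.assoc rop_twist_inverse[OF x2] flip: on_fst_simps(2))
  have "c *\<^sub>R (on_fst ?Z * on_snd (rop_sigma x3)) * ?F = c *\<^sub>R (on_fst ?Z * ?F * on_snd (rop_sigma x3))"
    by (simp only: mult_scaleR_left mult.assoc on_fst_on_snd_commute)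
  also have "\<dots> = ?F * (B13 + B23)"
    unfolding Z by (simp add: B13_def B23_def on_fst_simps(3) distrib_left distrib_right scaleR_add_right mult.assoc)
  finally have "c *\<^sub>R (on_fst ?Z * on_snd (rop_sigma x3)) * ?F = ?F * (B13 + B23)" .
  then have "rop_twist ?Z x3 * ?F = ?F * nexp (B13 + B23)"
    unfolding rop_twist_def[of ?Z] c_def[symmetric]
    by (intro fps_at_intertwine nilpotent_on_fst_on_snd nilpotent_add_commuting rop_sigma commB nB)
  also have "nexp (B13 + B23) = nexp B13 * nexp B23"
    by (rule nexp_add[OF commB nB])
  finally have "reassoc (rop_twist ?Z x3 * ?F) = reassoc ?F * nexp A13 * nexp A23"
    by (simp add: alg_homD[OF alg_hom_reassoc] alg_hom_fps_at[OF alg_hom_reassoc] nB reassocB mult.assoc)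
  also have "reassoc ?F = nexp (reassoc (on_fst (c *\<^sub>R (on_fst z1 * on_snd (rop_sigma x2)))))"
    unfolding rop_twist_def c_def[symmetric]
    by (simp only: alg_hom_fps_at[OF alg_hom_on_fst n12]
        alg_hom_fps_at[OF alg_hom_reassoc alg_hom_nilpotent[OF alg_hom_on_fst n12]])
  also have "reassoc (on_fst (c *\<^sub>R (on_fst z1 * on_snd (rop_sigma x2)))) = A12"
    by (simp add: on_fst_simps alg_homD[OF alg_hom_reassoc] reassoc_simps A12_def)
  \<comment> \<open>Primitivity of \<sigma> for the deformed coproduct merges the two exponents into
    that of a single twist.\<close>
  also have "nexp A12 * nexp A13 = rop_twist z1 (rop_twist z2 x3 * (on_fst x2 + on_snd x3) * rop_twist_inv z2 x3)"
    unfolding nexp_add[OF commA nA, symmetric] rop_twist_def[of z1] rop_sigma_twisted_coproduct[OF x3 x2 zx]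
    by (simp add: A12_def A13_def c_def on_snd_simps algebra_simps)
  also have "A23 = on_snd (c *\<^sub>R (on_fst z2 * on_snd (rop_sigma x3)))"
    by (simp add: on_snd_simps A23_def)
  also have "nexp \<dots> = on_snd (rop_twist z2 x3)"
    unfolding rop_twist_def c_def[symmetric] by (simp only: alg_hom_fps_at[OF alg_hom_on_snd n23])
  finally show ?thesis .
qed

subsection \<open>Spin representations and coupled bases\<close>

lemma finite_weights: "finite (weights j)"
proof (rule finite_subset)
  show "weights j \<subseteq> (\<lambda>k. j - of_int k) ` {0..\<lfloor>2 * j\<rfloor>}"
  proof
    fix m assume m: "m \<in> weights j"
    then obtain k where k: "j - m = of_int k"
      by (auto simp: weights_def Ints_def)
    then have "m = j - of_int k" "0 \<le> k" "k \<le> \<lfloor>2 * j\<rfloor>"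
      using m by (auto simp: weights_def le_floor_iff)
    then show "m \<in> (\<lambda>k. j - of_int k) ` {0..\<lfloor>2 * j\<rfloor>}"
      by auto
  qed
qed simp

lemma Jzero_spin_rep: "Jzero (spin_rep j) v i = (if i \<in> weights j then 2 * of_real i * v i else 0)"
proof -
  have "Jzero (spin_rep j) v i = (\<Sum>m\<in>weights j. if m = i then v m * (2 * m) else 0)"
    by (auto simp: spin_rep_def basis_vec_def intro!: sum.cong)
  then show ?thesis
    by (simp add: finite_weights)
qed

lemma Jplus_spin_rep:
  "Jplus (spin_rep j) v i =
    (if i \<in> weights j \<and> i - 1 \<in> weights j
     then of_real (sqrt ((j - i + 1) * (j + i))) * v (i - 1) else 0)"
proof -
  have "Jplus (spin_rep j) v i
      = (\<Sum>m\<in>weights j. if m = i - 1 then v m * sqrt ((j - m) * (j + m + 1)) else 0)"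
    by (auto simp: spin_rep_def basis_vec_def intro!: sum.cong)
  also have "\<dots> = (if i - 1 \<in> weights j then v (i - 1) * sqrt ((j - i + 1) * (j + i)) else 0)"
    by (simp only: sum.delta[OF finite_weights]) (simp add: diff_diff_eq2)
  finally have *: "Jplus (spin_rep j) v i
      = (if i - 1 \<in> weights j then v (i - 1) * sqrt ((j - i + 1) * (j + i)) else 0)" .
  show ?thesis
  \<comment> \<open>The boundary case: raising leaves the weights only from the top weight
    \<open>i - 1 = j\<close>, and there the square root vanishes.\<close>
  proof (cases "i - 1 \<in> weights j \<and> i \<notin> weights j")
    case True
    then obtain k where k: "j - (i - 1) = of_int k" and "- j \<le> i - 1" "i - 1 \<le> j"
      unfolding weights_def Ints_def by blast
    have "j - i = of_int (k - 1)"
      using k by simp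
    then have "j - i \<in> \<int>"
      by (simp only: Ints_of_int)
    then have "j < i"
      using True \<open>- j \<le> i - 1\<close> by (simp add: weights_def)
    then have "k < 1" "0 \<le> k"
      using k \<open>i - 1 \<le> j\<close> by linarith+
    then have "j - i + 1 = 0"
      using k by simp
    then show ?thesis
      using True by (simp add: *)
  qed (auto simp: *)
qed

lemma row_finite_Jzero: "row_finite (Jzero (spin_rep j))"
  unfolding row_finite_def
  by (intro conjI allI exI[of _ "weights j"] finite_weights) (auto simp: Jzero_spin_rep fun_eq_iff distrib_left)

lemma row_finite_Jplus: "row_finite (Jplus (spin_rep j))"
  unfolding row_finite_def
  by (intro conjI allI exI[of _ "weights j"] finite_weights) (auto simp: Jplus_spin_rep fun_eq_iff distrib_left)

definition spin_Jzero :: "real \<Rightarrow> real rop" where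
  "spin_Jzero j = Rop (Jzero (spin_rep j))"

definition spin_Jplus :: "real \<Rightarrow> real rop" where
  "spin_Jplus j = Rop (Jplus (spin_rep j))"

lemma app_spin_Jzero: "app (spin_Jzero j) = Jzero (spin_rep j)"
  by (simp add: spin_Jzero_def Rop_inverse row_finite_Jzero)

lemma app_spin_Jplus: "app (spin_Jplus j) = Jplus (spin_rep j)"
  by (simp add: spin_Jplus_def Rop_inverse row_finite_Jplus)

text \<open>A nonzero coordinate of the \<open>Suc n\<close>-th power joins two weights at distance
  \<open>Suc n\<close>, but weights differ by at most \<open>2 * j\<close>.\<close>

lemma nilpotent_spin_Jplus: "nilpotent (spin_Jplus j)"
proof -
  have support: "i - real (Suc n) \<in> weights j \<and> i \<in> weights j"
    if "app (spin_Jplus j ^ Suc n) v i \<noteq> 0" for n v i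
    using that
  proof (induction n arbitrary: i)
    case 0
    then show ?case
      by (auto simp: app_spin_Jplus Jplus_spin_rep split: if_splits)
  next
    case (Suc n)
    then have i: "i \<in> weights j" and "app (spin_Jplus j ^ Suc n) v (i - 1) \<noteq> 0"
      by (auto simp: power_Suc[of _ "Suc n"] app_mult app_spin_Jplus Jplus_spin_rep
          simp del: power_Suc split: if_splits)
    from Suc.IH[OF this(2)] i show ?case
      by (simp add: algebra_simps)
  qed
  obtain n :: nat where n: "2 * j < n"
    using reals_Archimedean2 by blast
  have "app (spin_Jplus j ^ Suc n) v i = 0" for v i
    using support[of n v i] n by (fastforce simp: weights_def)
  then have "spin_Jplus j ^ Suc n = 0"
    by (simp add: app_inject[symmetric] fun_eq_iff zero_rop.rep_eq)
  then show ?thesis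
    unfolding nilpotent_def by blast
qed

definition spin_x :: "complex \<Rightarrow> real \<Rightarrow> real rop" where
  "spin_x h j = scal (2 * h) * spin_Jplus j"

lemma represents_spin_rep: "represents h (spin_rep j) (spin_Jzero j) (spin_x h j)"
  unfolding represents_def spin_x_def
  by (auto simp: app_spin_Jzero app_spin_Jplus
      intro!: nilpotent_mult_commuting scal_commute nilpotent_spin_Jplus exI[of _ "spin_Jplus j"])

text \<open>Coordinatewise: raising from \<open>i - 1\<close> to \<open>i\<close> increases the
  eigenvalue \<open>2 m\<close> of \<open>Jzero\<close> by 2. The scalar \<open>2 * h\<close> does
  not disturb this.\<close>

lemma spin_commutator: "spin_Jzero j * spin_x h j = spin_x h j * spin_Jzero j + 2 *\<^sub>R spin_x h j"
proof -
  have "app (spin_Jzero j * spin_x h j) = app (spin_x h j * spin_Jzero j + 2 *\<^sub>R spin_x h j)"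
    by (auto simp: fun_eq_iff spin_x_def times_rop.rep_eq plus_rop.rep_eq scaleR_rop.rep_eq scal.rep_eq
        app_spin_Jzero app_spin_Jplus Jzero_spin_rep Jplus_spin_rep algebra_simps)
  then show ?thesis
    by (simp add: app_inject)
qed

section \<open>Threefold twists applied to undeformed coupled vectors\<close>

definition twist3_left :: "complex \<Rightarrow> real \<Rightarrow> real \<Rightarrow> real \<Rightarrow> ((real \<times> real) \<times> real) rop" where
  "twist3_left h a b c =
    (let F = rop_twist (spin_Jzero a) (spin_x h b)
     in rop_twist (F * (on_fst (spin_Jzero a) + on_snd (spin_Jzero b)) * rop_twist_inv (spin_Jzero a) (spin_x h b))
          (spin_x h c) * on_fst F)"

definition twist3_right :: "complex \<Rightarrow> real \<Rightarrow> real \<Rightarrow> real \<Rightarrow> (real \<times> (real \<times> real)) rop" where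
  "twist3_right h a b c =
    (let F = rop_twist (spin_Jzero b) (spin_x h c)
     in rop_twist (spin_Jzero a)
          (F * (on_fst (spin_x h b) + on_snd (spin_x h c)) * rop_twist_inv (spin_Jzero b) (spin_x h c))
          * on_snd F)"

lemma nilpotent_spin_x: "nilpotent (spin_x h j)"
  using represents_spin_rep by (auto simp: represents_def)

lemma reassoc_twist3_left: "reassoc (twist3_left h a b c) = twist3_right h a b c"
  unfolding twist3_left_def twist3_right_def Let_def
  by (rule twist_cocycle[OF nilpotent_spin_x nilpotent_spin_x spin_commutator])

text \<open>A left inverse makes the operator injective, which allows it to be cancelled from an
  expansion.\<close>

lemma twist3_right_left_inverse: "\<exists>Y. Y * twist3_right h a b c = 1"
proof -
  let ?b = "spin_Jzero b" and ?x = "spin_x h b" and ?y = "spin_x h c"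
  let ?t = "rop_twist ?b ?y * (on_fst ?x + on_snd ?y) * rop_twist_inv ?b ?y"
  have t: "nilpotent ?t"
    by (rule nilpotent_twisted_coproduct[OF nilpotent_spin_x nilpotent_spin_x spin_commutator])
  have "on_snd (rop_twist_inv ?b ?y) * rop_twist_inv (spin_Jzero a) ?t
      * (rop_twist (spin_Jzero a) ?t * on_snd (rop_twist ?b ?y))
      = on_snd (rop_twist_inv ?b ?y) * (rop_twist_inv (spin_Jzero a) ?t * rop_twist (spin_Jzero a) ?t)
        * on_snd (rop_twist ?b ?y)"
    by (simp only: mult.assoc)
  also have "\<dots> = 1"
    by (simp add: rop_twist_inverse[OF t] rop_twist_inverse[OF nilpotent_spin_x] on_snd_simps(1) flip: on_snd_simps(2))
  finally show ?thesis
    unfolding twist3_right_def Let_def by blast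
qed

definition coupled_left :: "real \<Rightarrow> real \<Rightarrow> real \<Rightarrow> real \<Rightarrow> real \<Rightarrow> real \<Rightarrow> ((real \<times> real) \<times> real) vec" where
  "coupled_left a b c d e \<epsilon> = (\<lambda>p.
    \<Sum>\<alpha>\<in>weights a. \<Sum>\<beta>\<in>weights b. \<Sum>\<gamma>\<in>weights c. \<Sum>\<delta>\<in>weights d.
      of_real (clebsch_gordan d c e \<delta> \<gamma> \<epsilon> * clebsch_gordan a b d \<alpha> \<beta> \<delta>)
      * ((basis_vec \<alpha> \<otimes>\<^sub>v basis_vec \<beta>) \<otimes>\<^sub>v basis_vec \<gamma>) p)"

definition coupled_right :: "real \<Rightarrow> real \<Rightarrow> real \<Rightarrow> real \<Rightarrow> real \<Rightarrow> real \<Rightarrow> (real \<times> (real \<times> real)) vec" where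
  "coupled_right a b c f e \<epsilon> = (\<lambda>p.
    \<Sum>\<alpha>\<in>weights a. \<Sum>\<beta>\<in>weights b. \<Sum>\<gamma>\<in>weights c. \<Sum>\<rho>\<in>weights f.
      of_real (clebsch_gordan a f e \<alpha> \<rho> \<epsilon> * clebsch_gordan b c f \<beta> \<gamma> \<rho>)
      * (basis_vec \<alpha> \<otimes>\<^sub>v (basis_vec \<beta> \<otimes>\<^sub>v basis_vec \<gamma>)) p)"

text \<open>The threefold twist does not depend on the summation indices, so by linearity it can be
  taken out of the Clebsch-Gordan sum.\<close>

lemma psi_left_eq: "psi_left h a b c d e \<epsilon> = app (twist3_left h a b c) (coupled_left a b c d e \<epsilon>)"
proof -
  note rep = represents_spin_rep[of h]
  have "twist h (tensor_rep h (spin_rep a) (spin_rep b)) (spin_rep c)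
      ((twist h (spin_rep a) (spin_rep b) \<otimes> id) v) = app (twist3_left h a b c) v" for v
    by (simp add: twist_eq_app[OF represents_tensor_rep[OF rep rep spin_commutator] rep]
        twist_eq_app[OF rep rep] app_tensor_id twist3_left_def Let_def times_rop.rep_eq)
  then show ?thesis
    unfolding psi_left_def coupled_left_def by (simp only: app_sum_right app_scale_right)
qed

lemma psi_right_eq: "psi_right h a b c f e \<epsilon> = app (twist3_right h a b c) (coupled_right a b c f e \<epsilon>)"
proof -
  note rep = represents_spin_rep[of h]
  have "twist h (spin_rep a) (tensor_rep h (spin_rep b) (spin_rep c))
      ((id \<otimes> twist h (spin_rep b) (spin_rep c)) v) = app (twist3_right h a b c) v" for v
    by (simp add: twist_eq_app[OF rep represents_tensor_rep[OF rep rep spin_commutator]]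
        twist_eq_app[OF rep rep] id_tensor_app twist3_right_def Let_def times_rop.rep_eq)
  then show ?thesis
    unfolding psi_right_def coupled_right_def by (simp only: app_sum_right app_scale_right)
qed

text \<open>The families agree as predicates, so neither existence nor uniqueness of the expansion
  matters for \<open>THE\<close>.\<close>

lemma racah_family_untwist:
  "racah_family h a b e c d W \<longleftrightarrow> racah_family 0 a b e c d W"
proof -
  let ?I = "intermediate_spins a b c e"
  define k where "k f = of_real (sqrt ((2 * d + 1) * (2 * f + 1))) * W f" for f
  \<comment> \<open>Stated for arbitrary \<open>h\<close>: the right-hand side is free of
    \<open>h\<close>, so the conditions for \<open>h\<close> and for 0 reduce to the same
    equation.\<close>
  have expansion: "(\<forall>\<alpha> \<beta> \<gamma>. psi_left h a b c d e \<epsilon> ((\<alpha>, \<beta>), \<gamma>)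
        = (\<Sum>f\<in>?I. k f * psi_right h a b c f e \<epsilon> (\<alpha>, (\<beta>, \<gamma>))))
      \<longleftrightarrow> (\<lambda>(\<alpha>, \<beta>, \<gamma>). coupled_left a b c d e \<epsilon> ((\<alpha>, \<beta>), \<gamma>))
        = (\<lambda>p. \<Sum>f\<in>?I. k f * coupled_right a b c f e \<epsilon> p)" for h \<epsilon>
  proof -
    obtain Y where Y: "Y * twist3_right h a b c = 1"
      using twist3_right_left_inverse by blast
    define T where "T = app (twist3_right h a b c)"
    define L where "L = (\<lambda>(\<alpha>, \<beta>, \<gamma>). coupled_left a b c d e \<epsilon> ((\<alpha>, \<beta>), \<gamma>))"
    define R where "R = (\<lambda>p. \<Sum>f\<in>?I. k f * coupled_right a b c f e \<epsilon> p)"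
    have "inj T"
      unfolding T_def by (rule inj_on_imageI2[of "app Y"]) (simp add: Y app_1 flip: app_mult)
    \<comment> \<open>Here the cocycle identity enters: after rebracketing, the left twist is the
      same operator \<open>T\<close> as the right one.\<close>
    have left: "psi_left h a b c d e \<epsilon> ((\<alpha>, \<beta>), \<gamma>) = T L (\<alpha>, \<beta>, \<gamma>)" for \<alpha> \<beta> \<gamma>
      by (simp add: T_def L_def psi_left_eq reassoc.rep_eq case_prod_unfold flip: reassoc_twist3_left)
    have right: "(\<Sum>f\<in>?I. k f * psi_right h a b c f e \<epsilon> p) = T R p" for p
      by (simp add: T_def R_def psi_right_eq app_sum_right app_scale_right)
    have "(\<forall>\<alpha> \<beta> \<gamma>. T L (\<alpha>, \<beta>, \<gamma>) = T R (\<alpha>, \<beta>, \<gamma>)) \<longleftrightarrow> T L = T R"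
      by (auto simp: fun_eq_iff)
    then show ?thesis
      unfolding left right L_def[symmetric] R_def[symmetric] using \<open>inj T\<close> by (simp add: inj_eq)
  qed
  show ?thesis
    unfolding racah_family_def k_def[symmetric] expansion by (rule refl)
qed

theorem lemma3p2:
  fixes h :: complex and a b c d e f :: real
  assumes "spin a" "spin b" "spin c" "spin d" "spin e" "spin f"
    and "triangle a b d" "triangle d c e" "triangle b c f" "triangle a f e"
  shows "racah h a b e c d f = racah 0 a b e c d f"
  unfolding racah_def racah_family_untwist[of h] by (rule refl)

end
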